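(* Let $(X,L)$ be a convergence space. (i) If $\mathsf S_{\mathrm{fin}}(\mathcal C_L,\mathcal C_L)$ holds, then $\mathsf S_1(\mathcal C_L,\operatorname{Cov}(X))$ holds if and only if Alice has no winning strategy in $\mathsf G_1(\mathcal C_L,\operatorname{Cov}(X))$. (ii) If every $L$-cover contains a countable subfamily that is still an $L$-cover, then $\mathsf S_{\mathrm{fin}}(\mathcal C_L,\operatorname{Cov}(X))$ holds if and only if Alice has no winning strategy in $\mathsf G_{\mathrm{fin}}(\mathcal C_L,\operatorname{Cov}(X))$.
   Context: All filters are proper. $\operatorname{Fil}(X)$ is the set of filters on $X$, and $\dot x=\{A\subseteq X:x\in A\}$. A convergence on $X$ is a function $L:\operatorname{Fil}(X)\to\mathcal P(X)$ such that $x\in L(\dot x)$ for every $x\in X$, and $L(\mathcal F)\subseteq L(\mathcal G)$ whenever $\mathcal F\subseteq\mathcal G$; then $(X,L)$ is a convergence space. A family $\mathcal U\subseteq\mathcal P(X)$ is an $L$-cover if $\mathcal U\cap\mathcal F\neq\varnothing$ for every $\mathcal F\in\operatorname{Fil}(X)$ with $L(\mathcal F)\neq\varnothing$; $\mathcal C_L$ is the family of all $L$-covers. $\operatorname{Cov}(X)$ is the family of all covers of $X$ by subsets of $X$. For collections $\mathcal A,\mathcal B$ of families of sets: $\mathsf S_1(\mathcal A,\mathcal B)$ asserts that for every sequence $\langle\mathcal U_n:n<\omega\rangle$ in $\mathcal A$ there are $U_n\in\mathcal U_n$ with $\{U_n:n<\omega\}\in\mathcal B$; $\mathsf S_{\mathrm{fin}}(\mathcal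 A,\mathcal B)$ asserts that there are finite $\mathcal V_n\subseteq\mathcal U_n$ with $\bigcup_{n<\omega}\mathcal V_n\in\mathcal B$. In the game $\mathsf G_1(\mathcal A,\mathcal B)$ (resp. $\mathsf G_{\mathrm{fin}}(\mathcal A,\mathcal B)$), in each inning $n<\omega$ Alice chooses $\mathcal U_n\in\mathcal A$ and then Bob chooses a member (resp. a finite subfamily) of $\mathcal U_n$; Bob wins if the family of all sets he selected belongs to $\mathcal B$, otherwise Alice wins. *)

theory Defs
  imports Complex_Main "HOL-Library.Countable_Set"
begin

text \<open>
  A (proper) filter on a set \<open>X\<close> is represented by a library filter on the ambient type that is
  different from \<open>bot\<close> and contains \<open>X\<close>; the family of subsets of \<open>X\<close> it stands for is
  \<open>filter_family X F\<close>, and lemma \<open>bij_betw_filter_family\<close> below shows that this is a bijection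
  onto the proper filters on \<open>X\<close> in the usual sense.  Working with a carrier set instead of a
  whole type keeps the empty space.  Pitfall: the library order on filters is
  reverse inclusion, i.e. the family of \<open>F\<close> is contained in that of \<open>G\<close> iff \<open>G \<le> F\<close>.
\<close>

definition Fil :: "'a set \<Rightarrow> 'a filter set" where
  "Fil X = {F. F \<noteq> bot \<and> F \<le> principal X}"

definition filter_family :: "'a set \<Rightarrow> 'a filter \<Rightarrow> 'a set set" where
  "filter_family X F = {A. A \<subseteq> X \<and> eventually (\<lambda>x. x \<in> A) F}"

lemma filter_family_principal_singleton:
  "filter_family X (principal {x}) = {A. A \<subseteq> X \<and> x \<in> A}"
  by (auto simp: filter_family_def eventually_principal)

lemma eventually_iff_filter_family:
  assumes "F \<le> principal X"
  shows "eventually P F \<longleftrightarrow> {x \<in> X. P x} \<in> filter_family X F"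
proof -
  have "eventually (\<lambda>x. x \<in> X) F"
    using assms by (simp add: le_principal)
  then show ?thesis
    by (auto simp: filter_family_def eventually_conj_iff)
qed

lemma filter_family_subset_iff:
  assumes "F \<in> Fil X" "G \<in> Fil X"
  shows "filter_family X F \<subseteq> filter_family X G \<longleftrightarrow> G \<le> F"
proof
  assume "filter_family X F \<subseteq> filter_family X G"
  then show "G \<le> F"
    using assms by (auto simp: le_filter_def Fil_def eventually_iff_filter_family[of _ X])
next
  assume "G \<le> F"
  then show "filter_family X F \<subseteq> filter_family X G"
    by (auto simp: filter_family_def le_filter_def)
qed

lemma bij_betw_filter_family:
  "bij_betw (filter_family X) (Fil X)
     {\<F>. \<F> \<subseteq> Pow X \<and> X \<in> \<F> \<and> {} \<notin> \<F> \<and>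
          (\<forall>A\<in>\<F>. \<forall>B\<in>\<F>. A \<inter> B \<in> \<F>) \<and>
          (\<forall>A\<in>\<F>. \<forall>B. A \<subseteq> B \<and> B \<subseteq> X \<longrightarrow> B \<in> \<F>)}"
    (is "bij_betw _ _ ?R")
  unfolding bij_betw_def
proof (intro conjI subset_antisym subsetI)
  show "inj_on (filter_family X) (Fil X)"
    by (intro inj_onI antisym) (simp_all flip: filter_family_subset_iff)
next
  fix \<F> assume "\<F> \<in> filter_family X ` Fil X"
  then obtain F where F: "\<F> = filter_family X F" "F \<noteq> bot" "F \<le> principal X"
    by (auto simp: Fil_def)
  then have "X \<in> \<F>" "{} \<notin> \<F>"
    by (auto simp: filter_family_def le_principal eventually_False)
  then show "\<F> \<in> ?R"
    by (auto simp: F(1) filter_family_def eventually_conj elim: eventually_mono)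
next
  fix \<F> assume \<F>: "\<F> \<in> ?R"
  define F where "F = Abs_filter (\<lambda>P. {x \<in> X. P x} \<in> \<F>)"
  have "is_filter (\<lambda>P. {x \<in> X. P x} \<in> \<F>)"
  proof
    show "{x \<in> X. True} \<in> \<F>" using \<F> by simp
  next
    fix P Q assume "{x \<in> X. P x} \<in> \<F>" "{x \<in> X. Q x} \<in> \<F>"
    moreover have "{x \<in> X. P x \<and> Q x} = {x \<in> X. P x} \<inter> {x \<in> X. Q x}" by auto
    ultimately show "{x \<in> X. P x \<and> Q x} \<in> \<F>" using \<F> by auto
  next
    fix P Q assume "\<forall>x. P x \<longrightarrow> Q x" "{x \<in> X. P x} \<in> \<F>"
    moreover from this(1) have "{x \<in> X. P x} \<subseteq> {x \<in> X. Q x}" by auto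
    moreover have "{x \<in> X. Q x} \<subseteq> X" by auto
    ultimately show "{x \<in> X. Q x} \<in> \<F>" using \<F> by blast
  qed
  then have ev: "eventually P F \<longleftrightarrow> {x \<in> X. P x} \<in> \<F>" for P
    unfolding F_def by (rule eventually_Abs_filter)
  have "F \<noteq> bot"
    using \<F> by (simp add: ev flip: eventually_False)
  moreover have "F \<le> principal X"
    using \<F> by (simp add: le_principal ev)
  moreover have "filter_family X F = \<F>"
  proof -
    have "{x \<in> X. x \<in> A} = A" if "A \<subseteq> X" for A using that by auto
    then show ?thesis using \<F> by (auto simp: filter_family_def ev)
  qed
  ultimately show "\<F> \<in> filter_family X ` Fil X"
    by (auto simp: Fil_def)
qed

definition convergence_space :: "'a set \<Rightarrow> ('a filter \<Rightarrow> 'a set) \<Rightarrow> bool" where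
  "convergence_space X L \<longleftrightarrow>
     (\<forall>F\<in>Fil X. L F \<subseteq> X) \<and>
     (\<forall>x\<in>X. x \<in> L (principal {x})) \<and>
     (\<forall>F\<in>Fil X. \<forall>G\<in>Fil X. filter_family X F \<subseteq> filter_family X G \<longrightarrow> L F \<subseteq> L G)"

definition L_covers :: "'a set \<Rightarrow> ('a filter \<Rightarrow> 'a set) \<Rightarrow> 'a set set set" where
  "L_covers X L =
     {\<U>. \<U> \<subseteq> Pow X \<and> (\<forall>F\<in>Fil X. L F \<noteq> {} \<longrightarrow> \<U> \<inter> filter_family X F \<noteq> {})}"

definition Cov :: "'a set \<Rightarrow> 'a set set set" where
  "Cov X = {\<U>. \<U> \<subseteq> Pow X \<and> \<Union>\<U> = X}"

definition S1 :: "'b set set \<Rightarrow> 'b set set \<Rightarrow> bool" where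
  "S1 \<A> \<B> \<longleftrightarrow>
     (\<forall>\<U> :: nat \<Rightarrow> 'b set. (\<forall>n. \<U> n \<in> \<A>) \<longrightarrow>
        (\<exists>U. (\<forall>n. U n \<in> \<U> n) \<and> range U \<in> \<B>))"

definition Sfin :: "'b set set \<Rightarrow> 'b set set \<Rightarrow> bool" where
  "Sfin \<A> \<B> \<longleftrightarrow>
     (\<forall>\<U> :: nat \<Rightarrow> 'b set. (\<forall>n. \<U> n \<in> \<A>) \<longrightarrow>
        (\<exists>\<V>. (\<forall>n. finite (\<V> n) \<and> \<V> n \<subseteq> \<U> n) \<and> (\<Union>n. \<V> n) \<in> \<B>))"

text \<open>
  A strategy \<open>\<sigma>\<close> for Alice maps the list of Bob's earlier moves (inning \<open>0\<close> first) to Alice's next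
  move.  It has to be legal (a member of \<open>\<A>\<close>) at every position that can arise when Alice follows
  \<open>\<sigma>\<close>, and it is winning if Bob wins no infinite play against it.  A play in which Bob has no
  legal move is thereby won by Alice.
  \<open>resp \<U>\<close> is the set of Bob's legal answers to \<open>\<U>\<close>, and \<open>sel b\<close> is the family selected by Bob when
  his moves are \<open>b 0, b 1, ...\<close>.
\<close>

definition Alice_winning_strategy ::
    "('c \<Rightarrow> 'm set) \<Rightarrow> ((nat \<Rightarrow> 'm) \<Rightarrow> 'c) \<Rightarrow> 'c set \<Rightarrow> 'c set \<Rightarrow> ('m list \<Rightarrow> 'c) \<Rightarrow> bool" where
  "Alice_winning_strategy resp sel \<A> \<B> \<sigma> \<longleftrightarrow>
     (\<forall>h. (\<forall>k<length h. h ! k \<in> resp (\<sigma> (take k h))) \<longrightarrow> \<sigma> h \<in> \<A>) \<and>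
     (\<forall>b. (\<forall>n. b n \<in> resp (\<sigma> (map b [0..<n]))) \<longrightarrow> sel b \<notin> \<B>)"

definition Alice_wins_G1 :: "'b set set \<Rightarrow> 'b set set \<Rightarrow> bool" where
  "Alice_wins_G1 \<A> \<B> \<longleftrightarrow> (\<exists>\<sigma>. Alice_winning_strategy (\<lambda>\<U>. \<U>) range \<A> \<B> \<sigma>)"

definition Alice_wins_Gfin :: "'b set set \<Rightarrow> 'b set set \<Rightarrow> bool" where
  "Alice_wins_Gfin \<A> \<B> \<longleftrightarrow>
     (\<exists>\<sigma>. Alice_winning_strategy (\<lambda>\<U>. {\<V>. finite \<V> \<and> \<V> \<subseteq> \<U>}) (\<lambda>b. \<Union>n. b n) \<A> \<B> \<sigma>)"

end

theory Submission
  imports Defs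
begin

text \<open>
  Both parts rest on one Hurewicz-type argument. Against a strategy of Alice that offers countable
  \<open>L\<close>-covers, let Bob answer \<open>k\<close> by selecting the first \<open>k\<close> members, so that positions become finite
  sequences of naturals. For a convergent filter \<open>F\<close> and a number \<open>n\<close>, monotonicity yields one \<open>k\<close>
  such that after any sequence of length at most \<open>n\<close> followed by \<open>k\<close> Bob has hit \<open>F\<close>. As this
  condition involves only finitely many sequences, it can be expressed by an \<open>L\<close>-cover, to which the
  selection principle applies. Tagging every set selected by the move \<open>k\<close> with all numbers below \<open>k\<close>
  and asking for each tag separately forces \<open>F\<close> to be hit in infinitely many innings.

  For the game \<open>G\<^sub>1\<close> (Pawlikowski), Alice plays in \<open>G\<^sub>f\<^sub>i\<^sub>n\<close> a common refinement of the covers at the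
  finitely many positions of \<open>G\<^sub>1\<close> reached so far. Against a play of Bob that hits every
  convergent filter infinitely often, the intersections of \<open>n + 1\<close> selected sets from distinct
  innings form an \<open>L\<close>-cover, and \<open>S\<^sub>1\<close> applied to these covers finds one set per inning.
\<close>

section \<open>Combinatorial preliminaries: uniform bounds and distinct choices\<close>

lemma exists_uniform_bound:
  fixes Q :: "'s \<Rightarrow> nat \<Rightarrow> bool"
  assumes "finite S" "\<And>s. s \<in> S \<Longrightarrow> \<exists>k. Q s k"
    and mono: "\<And>s k k'. Q s k \<Longrightarrow> k \<le> k' \<Longrightarrow> Q s k'"
  shows "\<exists>k. \<forall>s\<in>S. Q s k"
proof -
  have "\<forall>\<^sub>F k in sequentially. Q s k" if "s \<in> S" for s
    using assms(2)[OF that] mono by (auto simp: eventually_sequentially)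
  then have "\<forall>\<^sub>F k in sequentially. \<forall>s\<in>S. Q s k"
    using \<open>finite S\<close> by (simp add: eventually_ball_finite)
  then show ?thesis
    by (auto simp: eventually_sequentially)
qed

text \<open>Greedy recursion: at stage \<open>n\<close> at most \<open>n\<close> values are taken,
  fewer than the \<open>Suc n\<close> elements of \<open>I n\<close>.\<close>

lemma exists_distinct_choice:
  fixes I :: "nat \<Rightarrow> 'i set"
  assumes "\<And>n. card (I n) = Suc n"
  obtains f where "inj f" "\<And>n. f n \<in> I n"
proof -
  have "\<exists>f. \<forall>n. f n \<in> I n - f ` {..<n}"
  proof (rule dependent_wellorder_choice)
    fix r :: 'i and f g :: "nat \<Rightarrow> 'i" and n :: nat
    assume "\<And>y. y < n \<Longrightarrow> f y = g y"
    then have "f ` {..<n} = g ` {..<n}"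
      by (intro image_cong) auto
    then show "(r \<in> I n - f ` {..<n}) = (r \<in> I n - g ` {..<n})"
      by simp
  next
    fix n and f :: "nat \<Rightarrow> 'i"
    have "card (f ` {..<n}) < card (I n)"
      using card_image_le[of "{..<n}" f] assms[of n] by simp
    then have "\<not> I n \<subseteq> f ` {..<n}"
      by (meson card_mono finite_imageI finite_lessThan not_le)
    then show "\<exists>r. r \<in> I n - f ` {..<n}"
      by blast
  qed
  then obtain f where f: "\<And>n. f n \<in> I n - f ` {..<n}"
    by blast
  have "inj f"
  proof (rule linorder_injI)
    fix m n :: nat assume "m < n"
    then show "f m \<noteq> f n"
      using f[of n] by (metis DiffD2 imageI lessThan_iff)
  qed
  with f show ?thesis
    using that by blast
qed

subsection \<open>\<open>L\<close>-covers\<close>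

text \<open>Closure under finite intersections: \<open>A\<close> is the intersection of
  \<open>X\<close> with one member of the filter from each \<open>\<V> s\<close>.\<close>

lemma filter_family_finite_refinement:
  assumes "F \<in> Fil X" "finite S" "\<And>s. s \<in> S \<Longrightarrow> \<V> s \<inter> filter_family X F \<noteq> {}"
  shows "\<exists>A\<in>filter_family X F. \<forall>s\<in>S. \<exists>V\<in>\<V> s. A \<subseteq> V"
  using assms(2,3)
proof (induction S)
  case empty
  have "X \<in> filter_family X F"
    using assms(1) by (auto simp: Fil_def filter_family_def le_principal)
  then show ?case by blast
next
  case (insert s S)
  then obtain A where A: "A \<in> filter_family X F" "\<forall>t\<in>S. \<exists>V\<in>\<V> t. A \<subseteq> V"
    by auto
  obtain V where V: "V \<in> \<V> s" "V \<in> filter_family X F"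
    using insert.prems by blast
  have "A \<inter> V \<in> filter_family X F"
    using A(1) V(2) by (auto simp: filter_family_def eventually_conj)
  moreover have "\<exists>W\<in>\<V> t. A \<inter> V \<subseteq> W" if "t \<in> insert s S" for t
  proof (cases "t = s")
    case True
    then show ?thesis using V(1) by auto
  next
    case False
    then show ?thesis
      using that A(2) by (meson insertE le_infI1)
  qed
  ultimately show ?case
    by (intro bexI[where x = "A \<inter> V" and A = "filter_family X F"] ballI)
qed

lemma L_coversI:
  assumes "\<U> \<subseteq> Pow X"
    and "\<And>F. F \<in> Fil X \<Longrightarrow> L F \<noteq> {} \<Longrightarrow> \<exists>U\<in>\<U>. U \<in> filter_family X F"
  shows "\<U> \<in> L_covers X L"
  using assms by (fastforce simp: L_covers_def)

lemma L_coversD: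
  assumes "\<U> \<in> L_covers X L" "F \<in> Fil X" "L F \<noteq> {}"
  shows "\<U> \<inter> filter_family X F \<noteq> {}"
  using assms by (simp add: L_covers_def)

lemma L_covers_refined:
  assumes "\<U> \<in> L_covers X L" "\<V> \<subseteq> Pow X" "\<forall>U\<in>\<U>. \<exists>V\<in>\<V>. U \<subseteq> V"
  shows "\<V> \<in> L_covers X L"
proof (rule L_coversI[OF assms(2)])
  fix F assume "F \<in> Fil X" "L F \<noteq> {}"
  then obtain U where U: "U \<in> \<U>" "U \<in> filter_family X F"
    using L_coversD[OF assms(1)] by blast
  then obtain V where V: "V \<in> \<V>" "U \<subseteq> V"
    using assms(3) by blast
  then have "V \<in> filter_family X F"
    using U(2) assms(2) by (auto simp: filter_family_def elim: eventually_mono)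
  then show "\<exists>V\<in>\<V>. V \<in> filter_family X F"
    using V by blast
qed

lemma Cov_refined:
  assumes "\<U> \<in> Cov X" "\<V> \<subseteq> Pow X" "\<forall>U\<in>\<U>. \<exists>V\<in>\<V>. U \<subseteq> V"
  shows "\<V> \<in> Cov X"
proof -
  have "\<Union>\<U> \<subseteq> \<Union>\<V>"
    using assms(3) by (meson Union_iff subset_iff)
  then show ?thesis
    using assms(1,2) by (auto simp: Cov_def)
qed

text \<open>Selecting from the constant sequence \<open>\<U>\<close> gives a countable subfamily.
  This supplies in part (i) what part (ii) assumes.\<close>

lemma Sfin_countable_subcover:
  assumes "Sfin \<A> \<A>" "\<U> \<in> \<A>"
  shows "\<exists>\<V>\<subseteq>\<U>. countable \<V> \<and> \<V> \<in> \<A>"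
proof -
  obtain \<V> :: "nat \<Rightarrow> _" where "\<forall>n. finite (\<V> n) \<and> \<V> n \<subseteq> \<U>" "(\<Union>n. \<V> n) \<in> \<A>"
    using assms unfolding Sfin_def by (elim allE[of _ "\<lambda>_. \<U>"]) blast
  then show ?thesis
    by (intro exI[of _ "\<Union>n. \<V> n"]) (auto intro: countable_finite)
qed

subsection \<open>Positions in a game\<close>

text \<open>The legality condition inside \<open>Alice_winning_strategy\<close>, isolated so that
  positions can be treated by induction from the right.\<close>

definition legal :: "('c \<Rightarrow> 'm set) \<Rightarrow> ('m list \<Rightarrow> 'c) \<Rightarrow> 'm list \<Rightarrow> bool" where
  "legal resp \<sigma> h \<longleftrightarrow> (\<forall>k<length h. h ! k \<in> resp (\<sigma> (take k h)))"

lemma legal_Nil: "legal resp \<sigma> []"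
  by (simp add: legal_def)

lemma legal_snoc: "legal resp \<sigma> (h @ [v]) \<longleftrightarrow> legal resp \<sigma> h \<and> v \<in> resp (\<sigma> h)"
  by (auto simp: legal_def less_Suc_eq nth_append)

lemma legal_initial_segment:
  assumes "\<And>n. b n \<in> resp (\<sigma> (map b [0..<n]))"
  shows "legal resp \<sigma> (map b [0..<n])"
  by (induction n) (simp_all add: legal_Nil legal_snoc assms)

abbreviation fin_subsets :: "'b set \<Rightarrow> 'b set set" where
  "fin_subsets \<U> \<equiv> {\<V>. finite \<V> \<and> \<V> \<subseteq> \<U>}"

lemma Alice_winning_strategy_iff:
  "Alice_winning_strategy resp sel \<A> \<B> \<sigma> \<longleftrightarrow>
     (\<forall>h. legal resp \<sigma> h \<longrightarrow> \<sigma> h \<in> \<A>) \<and>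
     (\<forall>b. (\<forall>n. b n \<in> resp (\<sigma> (map b [0..<n]))) \<longrightarrow> sel b \<notin> \<B>)"
  by (simp add: Alice_winning_strategy_def legal_def)

text \<open>A sequence without a good selection gives Alice a winning strategy that only counts
  innings.\<close>

lemma S1_if_not_Alice_wins_G1:
  assumes "\<not> Alice_wins_G1 \<A> \<B>"
  shows "S1 \<A> \<B>"
  unfolding S1_def
proof (intro allI impI, rule ccontr)
  fix \<U> :: "nat \<Rightarrow> _"
  assume "\<forall>n. \<U> n \<in> \<A>" "\<nexists>U. (\<forall>n. U n \<in> \<U> n) \<and> range U \<in> \<B>"
  then have "Alice_winning_strategy (\<lambda>\<U>. \<U>) range \<A> \<B> (\<lambda>h. \<U> (length h))"
    by (auto simp: Alice_winning_strategy_def)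
  then show False
    using assms by (auto simp: Alice_wins_G1_def)
qed

lemma Sfin_if_not_Alice_wins_Gfin:
  assumes "\<not> Alice_wins_Gfin \<A> \<B>"
  shows "Sfin \<A> \<B>"
  unfolding Sfin_def
proof (intro allI impI, rule ccontr)
  fix \<U> :: "nat \<Rightarrow> _"
  assume "\<forall>n. \<U> n \<in> \<A>" "\<nexists>\<V>. (\<forall>n. finite (\<V> n) \<and> \<V> n \<subseteq> \<U> n) \<and> (\<Union>n. \<V> n) \<in> \<B>"
  then have "Alice_winning_strategy fin_subsets (\<lambda>b. \<Union>n. b n) \<A> \<B> (\<lambda>h. \<U> (length h))"
    by (auto simp: Alice_winning_strategy_def)
  then show False
    using assms by (auto simp: Alice_wins_Gfin_def)
qed

subsection \<open>Hurewicz's argument\<close>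

text \<open>Part (ii) takes \<open>Cov X\<close> for \<open>\<B>\<close> and the tail
  \<open>N = 0\<close>; the simulation of \<open>G\<^sub>1\<close> takes \<open>L_covers X L\<close>
  and all tails. Closure of \<open>\<B>\<close> under \<open>refined\<close> matters because Bob's
  sets are supersets of those that \<open>Sfin\<close> selects.\<close>

lemma Sfin_play_tails:
  fixes X :: "'a set" and \<sigma> :: "'a set set list \<Rightarrow> 'a set set"
  assumes lindelof: "\<And>\<U>. \<U> \<in> L_covers X L \<Longrightarrow> \<exists>\<V>\<subseteq>\<U>. countable \<V> \<and> \<V> \<in> L_covers X L"
    and Sfin: "Sfin (L_covers X L) \<B>"
    and refined: "\<And>\<U> \<V>. \<U> \<in> \<B> \<Longrightarrow> \<V> \<subseteq> Pow X \<Longrightarrow> \<forall>U\<in>\<U>. \<exists>V\<in>\<V>. U \<subseteq> V \<Longrightarrow> \<V> \<in> \<B>"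
    and strategy: "\<And>h. legal fin_subsets \<sigma> h \<Longrightarrow> \<sigma> h \<in> L_covers X L"
  shows "\<exists>b. (\<forall>n. b n \<in> fin_subsets (\<sigma> (map b [0..<n]))) \<and> (\<forall>N. (\<Union>n\<in>{N..}. b n) \<in> \<B>)"
proof -
  have "\<forall>h. \<exists>V. \<sigma> h \<in> L_covers X L \<longrightarrow> V \<subseteq> \<sigma> h \<and> countable V \<and> V \<in> L_covers X L"
    using lindelof by blast
  from choice[OF this] obtain C where
    C: "\<And>h. \<sigma> h \<in> L_covers X L \<Longrightarrow> C h \<subseteq> \<sigma> h \<and> countable (C h) \<and> C h \<in> L_covers X L"
    by blast
  \<comment> \<open>Intersecting with \<open>C h\<close> discards the arbitrary value of
    \<open>from_nat_into\<close> when \<open>C h\<close> is empty.\<close>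
  define move where "move h k = from_nat_into (C h) ` {..<k} \<inter> C h" for h and k :: nat
  define hist where "hist s = foldl (\<lambda>h k. h @ [move h k]) [] s" for s
  have hist_snoc: "hist (s @ [k]) = hist s @ [move (hist s) k]" for s k
    by (simp add: hist_def)
  have hist_legal: "legal fin_subsets \<sigma> (hist s)" for s
  proof (induction s rule: rev_induct)
    case Nil
    show ?case by (simp add: hist_def legal_Nil)
  next
    case (snoc k s)
    then show ?case
      using C[OF strategy[OF snoc]] by (auto simp: hist_snoc legal_snoc move_def)
  qed
  have C_hist: "C (hist s) \<subseteq> \<sigma> (hist s)" "countable (C (hist s))" "C (hist s) \<in> L_covers X L" for s
    using C[OF strategy[OF hist_legal]] by auto
  have move_mono: "move h k \<subseteq> move h k'" if "k \<le> k'" for h k k'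
    using that by (auto simp: move_def)

  \<comment> \<open>the sets with tag \<open>m\<close> that Bob has selected after the moves \<open>s\<close>\<close>
  define T where "T m s = (\<Union>i\<in>{i. i < length s \<and> m < s ! i}. move (hist (take i s)) (s ! i))"
    for m :: nat and s
  have T_snoc: "T m (s @ [k]) = T m s \<union> (if m < k then move (hist s) k else {})" for m s k
  proof -
    have "{i. i < length (s @ [k]) \<and> m < (s @ [k]) ! i} =
        {i. i < length s \<and> m < s ! i} \<union> (if m < k then {length s} else {})"
      by (auto simp: less_Suc_eq nth_append)
    then show ?thesis
      unfolding T_def by (auto simp: nth_append)
  qed
  have T_append: "T m s \<subseteq> T m (s @ t)" for m s t
  proof (induction t rule: rev_induct)
    case (snoc k t)
    then show ?case
      using T_snoc[of m "s @ t" k] by auto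
  qed simp
  have T_mono: "T m (s @ [k]) \<subseteq> T m (s @ [k'])" if "k \<le> k'" for m s k k'
    using that move_mono[OF that, of "hist s"] by (auto simp: T_snoc)
  \<comment> \<open>After \<open>t\<close>, a move \<open>j \<ge> k\<close> selects whatever
    \<open>k\<close> would, so a sequence with a large entry reduces to the prefix before
    it.\<close>
  have T_large: "T m (t @ [k]) \<subseteq> T m ((t @ j # u) @ [k'])" if "k \<le> j" for m t k j u k'
    using T_mono[OF that, of m t] T_append[of m "t @ [j]" "u @ [k']"] by auto

  \<comment> \<open>Induction on \<open>n\<close>: only finitely many sequences have all entries
    below the previous bound, and any other has a shorter prefix to which that bound
    applies.\<close>
  have hit: "\<exists>k. \<forall>s. length s < n \<longrightarrow> T m (s @ [k]) \<inter> filter_family X F \<noteq> {}"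
    if F: "F \<in> Fil X" "L F \<noteq> {}" for F m n
  proof (induction n)
    case (Suc n)
    then obtain k where k: "\<And>s. length s < n \<Longrightarrow> T m (s @ [k]) \<inter> filter_family X F \<noteq> {}"
      by blast
    have "\<exists>k'. T m (s @ [k']) \<inter> filter_family X F \<noteq> {}" for s
    proof -
      obtain V where V: "V \<in> C (hist s)" "V \<in> filter_family X F"
        using L_coversD[OF C_hist(3) F] by blast
      then obtain i where "from_nat_into (C (hist s)) i = V"
        using from_nat_into_surj C_hist(2) by metis
      \<comment> \<open>\<open>Suc i\<close> makes the move reach the item \<open>i\<close> of the
        enumeration; \<open>Suc m\<close> earns the tag \<open>m\<close>.\<close>
      then have "V \<in> move (hist s) (max (Suc i) (Suc m))"
        using V(1) by (auto simp: move_def)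
      then have "V \<in> T m (s @ [max (Suc i) (Suc m)])"
        by (simp add: T_snoc less_Suc_eq_le)
      then show ?thesis using V(2) by blast
    qed
    then have "\<exists>k'. \<forall>s\<in>{s. set s \<subseteq> {..<k} \<and> length s \<le> n}. T m (s @ [k']) \<inter> filter_family X F \<noteq> {}"
      using T_mono by (intro exists_uniform_bound finite_lists_length_le) (auto, blast)
    then obtain k' where k': "\<And>s. set s \<subseteq> {..<k} \<Longrightarrow> length s \<le> n \<Longrightarrow>
        T m (s @ [k']) \<inter> filter_family X F \<noteq> {}"
      by blast
    have "T m (s @ [k']) \<inter> filter_family X F \<noteq> {}" if s: "length s < Suc n" for s
    proof (cases "set s \<subseteq> {..<k}")
      case True
      then show ?thesis using k' s by simp
    next
      case False
      then obtain j where "j \<in> set s" "k \<le> j"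
        by (meson lessThan_iff not_le subsetI)
      then obtain t u where tu: "s = t @ j # u" by (metis split_list)
      then have "length t < n" using s by simp
      then show ?thesis
        using k[of t] T_large[OF \<open>k \<le> j\<close>, of m t u k'] tu by blast
    qed
    then show ?case by blast
  qed simp

  \<comment> \<open>The bound \<open>k\<close> may depend on \<open>A\<close> but not on
    \<open>s\<close>. Admitting every subset of the selected sets avoids naming
    intersections.\<close>
  define \<V> where "\<V> n m = {A. A \<subseteq> X \<and> (\<exists>k. \<forall>s. length s \<le> n \<longrightarrow> (\<exists>V\<in>T m (s @ [k]). A \<subseteq> V))}"
    for n m
  have \<V>: "\<V> n m \<in> L_covers X L" for n m
  proof (rule L_coversI)
    show "\<V> n m \<subseteq> Pow X" by (auto simp: \<V>_def)
  next
    fix F assume F: "F \<in> Fil X" "L F \<noteq> {}"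
    obtain k where k: "\<And>s. length s \<le> n \<Longrightarrow> T m (s @ [k]) \<inter> filter_family X F \<noteq> {}"
      using hit[OF F, of "Suc n" m] by (auto simp: less_Suc_eq_le)
    obtain A where A: "A \<in> filter_family X F"
      "\<And>s. set s \<subseteq> {..<k} \<Longrightarrow> length s \<le> n \<Longrightarrow> \<exists>V\<in>T m (s @ [k]). A \<subseteq> V"
      using filter_family_finite_refinement[OF F(1),
          of "{s. set s \<subseteq> {..<k} \<and> length s \<le> n}" "\<lambda>s. T m (s @ [k])"]
        k finite_lists_length_le[of "{..<k}" n]
      by auto
    have "\<exists>V\<in>T m (s @ [k]). A \<subseteq> V" if s: "length s \<le> n" for s
    proof (cases "set s \<subseteq> {..<k}")
      case True
      then show ?thesis using A(2) s by simp
    next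
      case False
      then have "\<exists>j\<in>set s. k \<le> j"
        by (meson lessThan_iff not_le subsetI)
      \<comment> \<open>Taking the first large entry keeps all entries of \<open>t\<close> below
        \<open>k\<close>, where \<open>A\<close> is known to refine.\<close>
      from split_list_first_prop[OF this]
      obtain t j u where tu: "s = t @ j # u" "k \<le> j" "\<forall>y\<in>set t. \<not> k \<le> y"
        by blast
      then have "\<exists>V\<in>T m (t @ [k]). A \<subseteq> V"
        using s by (intro A(2)) auto
      then show ?thesis
        using T_large[OF tu(2), of m t u k] tu(1) by blast
    qed
    then have "A \<in> \<V> n m"
      using A(1) by (auto simp: \<V>_def filter_family_def)
    then show "\<exists>A\<in>\<V> n m. A \<in> filter_family X F"
      using A(1) by blast
  qed

  \<comment> \<open>The innings are split into infinitely many infinite blocks, one for each tag.\<close>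
  have "\<exists>\<A>. (\<forall>j. finite (\<A> j) \<and> \<A> j \<subseteq> \<V> (prod_encode (m, j)) m) \<and> (\<Union>j. \<A> j) \<in> \<B>" for m
    using Sfin \<V> unfolding Sfin_def by simp
  then obtain \<A> where \<A>: "\<And>m j. finite (\<A> m j)" "\<And>m j. \<A> m j \<subseteq> \<V> (prod_encode (m, j)) m"
    "\<And>m. (\<Union>j. \<A> m j) \<in> \<B>"
    by metis
  have "\<exists>k. \<forall>A\<in>\<A> m j. \<forall>s. length s \<le> prod_encode (m, j) \<longrightarrow> (\<exists>V\<in>T m (s @ [k]). A \<subseteq> V)" for m j
  proof (rule exists_uniform_bound[OF \<A>(1)])
    fix A assume "A \<in> \<A> m j"
    then show "\<exists>k. \<forall>s. length s \<le> prod_encode (m, j) \<longrightarrow> (\<exists>V\<in>T m (s @ [k]). A \<subseteq> V)"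
      using \<A>(2)[of m j] by (auto simp: \<V>_def)
  next
    fix A and k k' :: nat
    assume A: "\<forall>s. length s \<le> prod_encode (m, j) \<longrightarrow> (\<exists>V\<in>T m (s @ [k]). A \<subseteq> V)" and "k \<le> k'"
    show "\<forall>s. length s \<le> prod_encode (m, j) \<longrightarrow> (\<exists>V\<in>T m (s @ [k']). A \<subseteq> V)"
      using A T_mono[OF \<open>k \<le> k'\<close>] by (meson subsetD)
  qed
  then obtain K where K: "\<And>m j A s. A \<in> \<A> m j \<Longrightarrow> length s \<le> prod_encode (m, j) \<Longrightarrow>
      \<exists>V\<in>T m (s @ [K m j]). A \<subseteq> V"
    by metis
  \<comment> \<open>\<open>K m j\<close> works after every sequence of length at most
    \<open>n\<close>, hence also after the one that Bob actually plays.\<close>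
  define \<kappa> where "\<kappa> n = (case prod_decode n of (m, j) \<Rightarrow> K m j)" for n
  define b where "b n = move (hist (map \<kappa> [0..<n])) (\<kappa> n)" for n
  have hist_b: "hist (map \<kappa> [0..<n]) = map b [0..<n]" for n
    by (induction n) (simp_all add: hist_snoc b_def, simp add: hist_def)
  have b: "b n \<in> fin_subsets (\<sigma> (map b [0..<n]))" for n
    using C_hist(1)[of "map \<kappa> [0..<n]"] unfolding hist_b
    by (auto simp: b_def move_def hist_b)
  moreover have "(\<Union>n\<in>{N..}. b n) \<in> \<B>" for N
  proof -
    \<comment> \<open>The sum bounds all moves before inning \<open>N\<close>, so a set with tag
      \<open>m\<close> can only come from inning \<open>N\<close> or later.\<close>
    define m where "m = (\<Sum>i<N. \<kappa> i)"
    have m: "\<kappa> i \<le> m" if "i < N" for i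
      unfolding m_def using that by (intro member_le_sum) auto
    have "\<exists>V\<in>(\<Union>n\<in>{N..}. b n). A \<subseteq> V" if A: "A \<in> (\<Union>j. \<A> m j)" for A
    proof -
      obtain j where "A \<in> \<A> m j" using A by blast
      define n where "n = prod_encode (m, j)"
      have "\<kappa> n = K m j" by (simp add: \<kappa>_def n_def)
      then obtain V where V: "V \<in> T m (map \<kappa> [0..<n] @ [\<kappa> n])" "A \<subseteq> V"
        using K[OF \<open>A \<in> \<A> m j\<close>, of "map \<kappa> [0..<n]"] by (auto simp: n_def)
      have "map \<kappa> [0..<n] @ [\<kappa> n] = map \<kappa> [0..<Suc n]" by simp
      then have "V \<in> T m (map \<kappa> [0..<Suc n])" using V(1) by metis
      then have "\<exists>i. i < Suc n \<and> m < \<kappa> i \<and> V \<in> b i"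
        by (fastforce simp: T_def b_def take_map simp del: upt_Suc)
      then obtain i where i: "m < \<kappa> i" "V \<in> b i"
        by blast
      then have "N \<le> i" using m[of i] by (meson not_le)
      then show ?thesis using i V(2) by auto
    qed
    moreover have "\<sigma> (map b [0..<n]) \<subseteq> Pow X" for n
      using strategy[OF legal_initial_segment[of b fin_subsets \<sigma>, OF b]] by (simp add: L_covers_def)
    then have "(\<Union>n\<in>{N..}. b n) \<subseteq> Pow X"
      using b by blast
    ultimately show ?thesis
      by (intro refined[OF \<A>(3)[of m]]) auto
  qed
  ultimately show ?thesis by blast
qed

lemma not_Alice_wins_Gfin:
  assumes lindelof: "\<And>\<U>. \<U> \<in> L_covers X L \<Longrightarrow> \<exists>\<V>\<subseteq>\<U>. countable \<V> \<and> \<V> \<in> L_covers X L"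
    and Sfin: "Sfin (L_covers X L) (Cov X)"
  shows "\<not> Alice_wins_Gfin (L_covers X L) (Cov X)"
proof
  assume "Alice_wins_Gfin (L_covers X L) (Cov X)"
  then obtain \<sigma> where \<sigma>:
    "Alice_winning_strategy fin_subsets (\<lambda>b. \<Union>n. b n) (L_covers X L) (Cov X) \<sigma>"
    unfolding Alice_wins_Gfin_def by (elim exE)
  then have \<sigma>_cover: "\<sigma> h \<in> L_covers X L" if "legal fin_subsets \<sigma> h" for h
    using that by (simp add: Alice_winning_strategy_iff)
  have "\<exists>b. (\<forall>n. b n \<in> fin_subsets (\<sigma> (map b [0..<n]))) \<and> (\<forall>N. (\<Union>n\<in>{N..}. b n) \<in> Cov X)"
    by (rule Sfin_play_tails[of X L]) (fact lindelof Sfin Cov_refined \<sigma>_cover)+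
  then obtain b where
    b: "\<forall>n. b n \<in> fin_subsets (\<sigma> (map b [0..<n]))" "\<forall>N. (\<Union>n\<in>{N..}. b n) \<in> Cov X"
    by (elim exE conjE)
  have "(\<Union>n. b n) \<in> Cov X"
    using b(2)[rule_format, of 0] by (simp add: atLeast_0)
  then show False
    using \<sigma> b(1) by (simp add: Alice_winning_strategy_iff)
qed

subsection \<open>Pawlikowski's argument\<close>

text \<open>As all tails are \<open>L\<close>-covers, a convergent filter meets infinitely many
  \<open>\<F> i\<close>. The \<open>n + 1\<close> innings behind the set chosen from
  \<open>\<W> n\<close> leave room for an injective choice; the remaining innings contribute
  \<open>{}\<close>.\<close>

lemma S1_select_one_per_inning:
  fixes \<F> :: "nat \<Rightarrow> 'a set set"
  assumes S1: "S1 (L_covers X L) (Cov X)"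
    and tails: "\<And>N. (\<Union>n\<in>{N..}. \<F> n) \<in> L_covers X L"
  obtains A where "\<And>n. A n \<in> insert {} (\<F> n)" "(\<Union>n. A n) = X"
proof -
  define \<W> where "\<W> n = {B. B \<subseteq> X \<and> (\<exists>I. card I = Suc n \<and> (\<forall>i\<in>I. \<exists>V\<in>\<F> i. B \<subseteq> V))}" for n
  have "\<W> n \<in> L_covers X L" for n
  proof (rule L_coversI)
    show "\<W> n \<subseteq> Pow X" by (auto simp: \<W>_def)
  next
    fix F assume F: "F \<in> Fil X" "L F \<noteq> {}"
    have "\<exists>i\<ge>N. \<F> i \<inter> filter_family X F \<noteq> {}" for N
      using L_coversD[OF tails[of N] F] by auto
    then have "infinite {i. \<F> i \<inter> filter_family X F \<noteq> {}}"
      by (simp add: infinite_nat_iff_unbounded_le)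
    then obtain I where I: "I \<subseteq> {i. \<F> i \<inter> filter_family X F \<noteq> {}}" "finite I" "card I = Suc n"
      using infinite_arbitrarily_large by metis
    have "\<exists>B\<in>filter_family X F. \<forall>i\<in>I. \<exists>V\<in>\<F> i. B \<subseteq> V"
      using I(1) by (intro filter_family_finite_refinement[OF F(1) I(2)]) auto
    then obtain B where B: "B \<in> filter_family X F" "\<forall>i\<in>I. \<exists>V\<in>\<F> i. B \<subseteq> V"
      by (rule bexE)
    then have "B \<in> \<W> n"
      using I(3) by (auto simp: \<W>_def filter_family_def)
    then show "\<exists>B\<in>\<W> n. B \<in> filter_family X F"
      using B(1) by blast
  qed
  then obtain w where w: "\<And>n. w n \<in> \<W> n" "range w \<in> Cov X"
    using S1 unfolding S1_def by meson
  have "\<forall>n. \<exists>I. card I = Suc n \<and> (\<forall>i\<in>I. \<exists>V\<in>\<F> i. w n \<subseteq> V)"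
    using w(1) by (simp add: \<W>_def)
  from choice[OF this] obtain I where
    I: "\<And>n. card (I n) = Suc n" "\<And>n i. i \<in> I n \<Longrightarrow> \<exists>V\<in>\<F> i. w n \<subseteq> V"
    by auto
  obtain f where f: "inj f" "\<And>n. f n \<in> I n"
    using exists_distinct_choice[of I] I(1) by metis
  obtain V where V: "\<And>n. V n \<in> \<F> (f n)" "\<And>n. w n \<subseteq> V n"
    using I(2)[OF f(2)] by metis
  define A where "A i = (if i \<in> range f then V (inv f i) else {})" for i
  have A_f: "A (f n) = V n" for n
    using f(1) by (simp add: A_def)
  have A: "A i \<in> insert {} (\<F> i)" for i
    using V(1) A_f by (cases "i \<in> range f") (auto simp: A_def)
  moreover have "(\<Union>n. A n) = X"
  proof
    have "\<F> i \<subseteq> Pow X" for i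
      using tails[of 0] by (auto simp: L_covers_def)
    then show "(\<Union>n. A n) \<subseteq> X"
      using A by blast
    have "X = (\<Union>n. w n)"
      using w(2) by (simp add: Cov_def)
    also have "\<dots> \<subseteq> (\<Union>n. A n)"
      using V(2) A_f by blast
    finally show "X \<subseteq> (\<Union>n. A n)" .
  qed
  ultimately show ?thesis by (rule that)
qed

lemma not_Alice_wins_G1:
  assumes Sfin: "Sfin (L_covers X L) (L_covers X L)"
    and S1: "S1 (L_covers X L) (Cov X)"
  shows "\<not> Alice_wins_G1 (L_covers X L) (Cov X)"
proof
  assume "Alice_wins_G1 (L_covers X L) (Cov X)"
  then obtain \<sigma> where \<sigma>:
    "Alice_winning_strategy (\<lambda>\<U>. \<U>) range (L_covers X L) (Cov X) \<sigma>"
    unfolding Alice_wins_G1_def by (elim exE)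
  then have \<sigma>_cover: "\<sigma> h \<in> L_covers X L" if "legal (\<lambda>\<U>. \<U>) \<sigma> h" for h
    using that by (simp add: Alice_winning_strategy_iff)
  \<comment> \<open>On a constant sequence \<open>{}\<close>, \<open>S1\<close> would fail. Nonempty
    covers let Bob answer even when the simulated set is empty.\<close>
  have nonempty: "\<U> \<noteq> {}" if "\<U> \<in> L_covers X L" for \<U>
    using S1 that unfolding S1_def by (elim allE[of _ "\<lambda>_. \<U>"]) auto
  \<comment> \<open>Bob's answer in \<open>G\<^sub>1\<close> at the position \<open>h\<close> when
    he simulates the selection of \<open>A\<close>.\<close>
  define r where "r h A = (SOME U. U \<in> \<sigma> h \<and> A \<subseteq> U)" for h A
  have r: "r h A \<in> \<sigma> h \<and> A \<subseteq> r h A" if "\<exists>U\<in>\<sigma> h. A \<subseteq> U" for h A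
    using that unfolding r_def by (intro someI_ex[of "\<lambda>U. U \<in> \<sigma> h \<and> A \<subseteq> U"]) blast

  \<comment> \<open>\<open>H \<F>s\<close> consists of the positions of \<open>G\<^sub>1\<close> that are simulated at the position \<open>\<F>s\<close> of \<open>G\<^sub>f\<^sub>i\<^sub>n\<close>.
    The empty set is inserted because Bob may select nothing in an inning of \<open>G\<^sub>f\<^sub>i\<^sub>n\<close>.\<close>
  define H where "H \<F>s = foldl (\<lambda>P \<F>. (\<lambda>(h, A). h @ [r h A]) ` (P \<times> insert {} \<F>)) {[]} \<F>s" for \<F>s
  define \<tau> where "\<tau> \<F>s = {A. A \<subseteq> X \<and> (\<forall>h\<in>H \<F>s. \<exists>U\<in>\<sigma> h. A \<subseteq> U)}" for \<F>s
  have H_Nil: "H [] = {[]}"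
    by (simp add: H_def)
  have H_snoc: "H (\<F>s @ [\<F>]) = (\<lambda>(h, A). h @ [r h A]) ` (H \<F>s \<times> insert {} \<F>)" for \<F>s \<F>
    by (simp add: H_def)
  have r_H: "r h A \<in> \<sigma> h \<and> A \<subseteq> r h A"
    if "h \<in> H \<F>s" "legal (\<lambda>\<U>. \<U>) \<sigma> h" "\<F> \<subseteq> \<tau> \<F>s" "A \<in> insert {} \<F>" for h A \<F>s \<F>
  proof (rule r)
    show "\<exists>U\<in>\<sigma> h. A \<subseteq> U"
      using that nonempty[OF \<sigma>_cover[OF that(2)]] by (auto simp: \<tau>_def)
  qed
  have H: "finite (H \<F>s) \<and> (\<forall>h\<in>H \<F>s. legal (\<lambda>\<U>. \<U>) \<sigma> h)" if "legal fin_subsets \<tau> \<F>s" for \<F>s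
    using that
  proof (induction \<F>s rule: rev_induct)
    case Nil
    show ?case by (simp add: H_Nil legal_Nil)
  next
    case (snoc \<F> \<F>s)
    then have "finite (H \<F>s)" "\<And>h. h \<in> H \<F>s \<Longrightarrow> legal (\<lambda>\<U>. \<U>) \<sigma> h" "finite \<F>" "\<F> \<subseteq> \<tau> \<F>s"
      by (auto simp: legal_snoc)
    then show ?case
      using r_H[of _ \<F>s \<F>] by (auto simp: H_snoc legal_snoc)
  qed
  \<comment> \<open>Only finitely many positions are simulated, so one member of the filter refines
    all their covers.\<close>
  have \<tau>: "\<tau> \<F>s \<in> L_covers X L" if "legal fin_subsets \<tau> \<F>s" for \<F>s
  proof (rule L_coversI)
    show "\<tau> \<F>s \<subseteq> Pow X" by (auto simp: \<tau>_def)
  next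
    fix F assume F: "F \<in> Fil X" "L F \<noteq> {}"
    have "\<exists>A\<in>filter_family X F. \<forall>h\<in>H \<F>s. \<exists>U\<in>\<sigma> h. A \<subseteq> U"
    proof (rule filter_family_finite_refinement[OF F(1)])
      show "finite (H \<F>s)" using H[OF that] by blast
    next
      fix h assume "h \<in> H \<F>s"
      then have "legal (\<lambda>\<U>. \<U>) \<sigma> h" using H[OF that] by blast
      then show "\<sigma> h \<inter> filter_family X F \<noteq> {}"
        using L_coversD[OF \<sigma>_cover F] by blast
    qed
    then show "\<exists>A\<in>\<tau> \<F>s. A \<in> filter_family X F"
      by (auto simp: \<tau>_def filter_family_def)
  qed
  have "\<exists>\<F>. (\<forall>n. \<F> n \<in> fin_subsets (\<tau> (map \<F> [0..<n]))) \<and>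
      (\<forall>N. (\<Union>n\<in>{N..}. \<F> n) \<in> L_covers X L)"
    by (rule Sfin_play_tails[of X L]) (fact Sfin_countable_subcover[OF Sfin] Sfin L_covers_refined \<tau>)+
  then obtain \<F> where
    \<F>': "\<forall>n. \<F> n \<in> fin_subsets (\<tau> (map \<F> [0..<n]))" "\<forall>N. (\<Union>n\<in>{N..}. \<F> n) \<in> L_covers X L"
    by (elim exE conjE)
  note \<F> = \<F>'[rule_format]
  obtain A where A: "\<And>n. A n \<in> insert {} (\<F> n)" "(\<Union>n. A n) = X"
    using S1_select_one_per_inning[of X L \<F>, OF S1 \<F>(2)] by blast
  \<comment> \<open>The sets \<open>A n\<close> single out one branch among the simulated
    positions.\<close>
  define h where "h n = rec_nat [] (\<lambda>n h. h @ [r h (A n)]) n" for n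
  define b where "b n = r (h n) (A n)" for n
  have h_b: "h n = map b [0..<n]" for n
    by (induction n) (simp_all add: h_def b_def)
  have h_H: "h n \<in> H (map \<F> [0..<n])" for n
  proof (induction n)
    case 0
    show ?case by (simp add: h_def H_Nil)
  next
    case (Suc n)
    then show ?case
      using A(1)[of n] by (auto simp: h_b b_def H_snoc image_iff)
  qed
  have b: "b n \<in> \<sigma> (map b [0..<n]) \<and> A n \<subseteq> b n" for n
    unfolding h_b[symmetric] b_def
    using h_H[of n] H[OF legal_initial_segment[of \<F> fin_subsets \<tau>, OF \<F>(1)]] \<F>(1)[of n] A(1)[of n]
    by (intro r_H) auto
  have "\<sigma> (map b [0..<n]) \<subseteq> Pow X" for n
    using \<sigma>_cover[OF legal_initial_segment[of b "\<lambda>\<U>. \<U>" \<sigma>]] b by (auto simp: L_covers_def)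
  then have "range b \<in> Cov X"
    using b A(2) unfolding Cov_def by blast
  then show False
    using \<sigma> b unfolding Alice_winning_strategy_iff by blast
qed

theorem theorem3p4:
  fixes X :: "'a set" and L :: "'a filter \<Rightarrow> 'a set"
  assumes "convergence_space X L"
  shows "(Sfin (L_covers X L) (L_covers X L) \<longrightarrow>
            (S1 (L_covers X L) (Cov X) \<longleftrightarrow> \<not> Alice_wins_G1 (L_covers X L) (Cov X))) \<and>
         ((\<forall>\<U>\<in>L_covers X L. \<exists>\<V>\<subseteq>\<U>. countable \<V> \<and> \<V> \<in> L_covers X L) \<longrightarrow>
            (Sfin (L_covers X L) (Cov X) \<longleftrightarrow> \<not> Alice_wins_Gfin (L_covers X L) (Cov X)))"
proof (intro conjI impI iffI)
  assume "Sfin (L_covers X L) (L_covers X L)" "S1 (L_covers X L) (Cov X)"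
  then show "\<not> Alice_wins_G1 (L_covers X L) (Cov X)"
    by (rule not_Alice_wins_G1)
next
  assume "\<forall>\<U>\<in>L_covers X L. \<exists>\<V>\<subseteq>\<U>. countable \<V> \<and> \<V> \<in> L_covers X L"
    and "Sfin (L_covers X L) (Cov X)"
  then show "\<not> Alice_wins_Gfin (L_covers X L) (Cov X)"
    by (intro not_Alice_wins_Gfin) simp_all
qed (simp_all add: S1_if_not_Alice_wins_G1 Sfin_if_not_Alice_wins_Gfin)

end
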